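(* Let $\kappa$ denote any one of the three properties "compact", "countably compact", "sequentially compact" (the same choice throughout). Let $G$ be a topological gyrogroup and $H$ a closed $L$-subgyrogroup of $G$ such that every $\kappa$ subset of $H$ is first-countable. Then: (a) if every $\kappa$ subset of $G/H$ is strongly Fréchet-Urysohn, then every $\kappa$ subset of $G$ is strongly Fréchet-Urysohn; (b) if every $\kappa$ subset of $G/H$ is strictly Fréchet-Urysohn, then every $\kappa$ subset of $G$ is strictly Fréchet-Urysohn. (Subsets carry the subspace topology.)
   Context: All topological spaces are assumed Hausdorff; $\mathbb{N}$ is the set of positive integers. A groupoid $(G,\oplus)$ (a set with a binary operation) is a gyrogroup if: (G1) there is a unique identity element $0\in G$ with $0\oplus a=a=a\oplus 0$ for all $a\in G$; (G2) for every $x\in G$ there is a unique inverse $\ominus x\in G$ with $\ominus x\oplus x=0=x\oplus(\ominus x)$; (G3) for all $x,y\in G$ there is an automorphism $\mathrm{gyr}[x,y]\in \mathrm{Aut}(G,\oplus)$ with $x\oplus(y\oplus z)=(x\oplus y)\oplus \mathrm{gyr}[x,y](z)$ for all $z\in G$; (G4) $\mathrm{gyr}[x\oplus y,y]=\mathrm{gyr}[x,y]$ for all $x,y\in G$. A topological gyrogroup is a gyrogroup $(G,\oplus)$ with a topology such that $\oplus:G\times G\to G$ is jointly continuous (product topology on $G\times G$) and $x\mapsto\ominus x$ is continuous. A nonempty subset $H\subset G$ is a subgyrogroup if $H$ is a gyrogroup under the inherited operation and the restriction of $\mathrm{gyr}[a,b]$ to $H$ is an automorphism of $H$ for all $a,b\in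 H$. It is an $L$-subgyrogroup if in addition $\mathrm{gyr}[a,h](H)=H$ for all $a\in G$, $h\in H$. For an $L$-subgyrogroup $H$, the left cosets $a\oplus H$ ($a\in G$) partition $G$; $G/H=\{a\oplus H:a\in G\}$ carries the quotient topology with respect to $\pi:G\to G/H$, $\pi(a)=a\oplus H$, i.e. $O\subset G/H$ is open iff $\pi^{-1}(O)$ is open in $G$. A space $X$ is strictly (respectively strongly) Fréchet-Urysohn if for every $x\in X$ and every sequence (respectively every decreasing sequence) $\{A_n\}_{n\in\mathbb{N}}$ of subsets of $X$ with $x\in\bigcap_{n\in\mathbb{N}}\overline{A_n}$, there are $x_n\in A_n$ ($n\in\mathbb{N}$) such that $\{x_n\}_{n\in\mathbb{N}}$ converges to $x$. *)

theory Defs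
  imports "HOL-Analysis.Analysis"
begin

section \<open>Gyrogroups\<close>

definition gyro_aut :: "'a set \<Rightarrow> ('a \<Rightarrow> 'a \<Rightarrow> 'a) \<Rightarrow> ('a \<Rightarrow> 'a) set" where
  "gyro_aut G add = {f. bij_betw f G G \<and> (\<forall>a\<in>G. \<forall>b\<in>G. f (add a b) = add (f a) (f b))}"

text \<open>The identity, the inverse operation and the gyrations are parameters. On the carrier
  they are determined by the binary operation: the first two by the uniqueness clauses, the
  gyrations by \<open>gyr_unique\<close> below. Their values outside the carrier are irrelevant.\<close>

locale gyrogroup =
  fixes G :: "'a set"
    and add :: "'a \<Rightarrow> 'a \<Rightarrow> 'a" (infixl "\<oplus>" 65)
    and zero :: 'a ("\<zero>")
    and neg :: "'a \<Rightarrow> 'a" ("\<ominus> _" [81] 80)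
    and gyr :: "'a \<Rightarrow> 'a \<Rightarrow> 'a \<Rightarrow> 'a"
  assumes add_closed: "\<And>x y. \<lbrakk>x \<in> G; y \<in> G\<rbrakk> \<Longrightarrow> x \<oplus> y \<in> G"
    and zero_closed: "\<zero> \<in> G"
    and zero_left: "\<And>a. a \<in> G \<Longrightarrow> \<zero> \<oplus> a = a"
    and zero_right: "\<And>a. a \<in> G \<Longrightarrow> a \<oplus> \<zero> = a"
    and zero_unique: "\<And>e. \<lbrakk>e \<in> G; \<forall>a\<in>G. e \<oplus> a = a \<and> a \<oplus> e = a\<rbrakk> \<Longrightarrow> e = \<zero>"
    and neg_closed: "\<And>x. x \<in> G \<Longrightarrow> \<ominus> x \<in> G"
    and neg_left: "\<And>x. x \<in> G \<Longrightarrow> (\<ominus> x) \<oplus> x = \<zero>"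
    and neg_right: "\<And>x. x \<in> G \<Longrightarrow> x \<oplus> (\<ominus> x) = \<zero>"
    and neg_unique: "\<And>x y. \<lbrakk>x \<in> G; y \<in> G; y \<oplus> x = \<zero>; x \<oplus> y = \<zero>\<rbrakk> \<Longrightarrow> y = \<ominus> x"
    and gyr_aut: "\<And>x y. \<lbrakk>x \<in> G; y \<in> G\<rbrakk> \<Longrightarrow> gyr x y \<in> gyro_aut G (\<oplus>)"
    and gyr_assoc: "\<And>x y z. \<lbrakk>x \<in> G; y \<in> G; z \<in> G\<rbrakk> \<Longrightarrow> x \<oplus> (y \<oplus> z) = (x \<oplus> y) \<oplus> gyr x y z"
    and gyr_loop: "\<And>x y z. \<lbrakk>x \<in> G; y \<in> G; z \<in> G\<rbrakk> \<Longrightarrow> gyr (x \<oplus> y) y z = gyr x y z"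
begin

lemma left_cancel:
  assumes "a \<in> G" "b \<in> G" "c \<in> G" "a \<oplus> b = a \<oplus> c"
  shows "b = c"
proof -
  have *: "(\<ominus> a) \<oplus> (a \<oplus> z) = gyr (\<ominus> a) a z \<and> gyr (\<ominus> a) a z \<in> G" if "z \<in> G" for z
  proof -
    have "gyr (\<ominus> a) a z \<in> G"
      using gyr_aut[of "\<ominus> a" a] assms(1) neg_closed that
      by (auto simp: gyro_aut_def bij_betw_def)
    then show ?thesis
      using gyr_assoc[of "\<ominus> a" a z] assms(1) neg_closed neg_left zero_left that by simp
  qed
  have "inj_on (gyr (\<ominus> a) a) G"
    using gyr_aut[of "\<ominus> a" a] assms(1) neg_closed by (auto simp: gyro_aut_def bij_betw_def)
  then show ?thesis
    using *[of b] *[of c] assms by (metis inj_onD)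
qed

lemma gyr_unique:
  assumes "x \<in> G" "y \<in> G" "z \<in> G" "w \<in> G" "x \<oplus> (y \<oplus> z) = (x \<oplus> y) \<oplus> w"
  shows "w = gyr x y z"
proof -
  have "gyr x y z \<in> G"
    using gyr_aut[of x y] assms by (auto simp: gyro_aut_def bij_betw_def)
  then show ?thesis
    using assms add_closed gyr_assoc[of x y z] left_cancel[of "x \<oplus> y"] by metis
qed

end

definition subgyrogroup ::
    "'a set \<Rightarrow> ('a \<Rightarrow> 'a \<Rightarrow> 'a) \<Rightarrow> ('a \<Rightarrow> 'a \<Rightarrow> 'a \<Rightarrow> 'a) \<Rightarrow> 'a set \<Rightarrow> bool" where
  "subgyrogroup G add gyr H \<longleftrightarrow>
     H \<noteq> {} \<and> H \<subseteq> G \<and>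
     (\<exists>zero neg gyr'. gyrogroup H add zero neg gyr') \<and>
     (\<forall>a\<in>H. \<forall>b\<in>H. gyr a b \<in> gyro_aut H add)"

definition L_subgyrogroup ::
    "'a set \<Rightarrow> ('a \<Rightarrow> 'a \<Rightarrow> 'a) \<Rightarrow> ('a \<Rightarrow> 'a \<Rightarrow> 'a \<Rightarrow> 'a) \<Rightarrow> 'a set \<Rightarrow> bool" where
  "L_subgyrogroup G add gyr H \<longleftrightarrow>
     subgyrogroup G add gyr H \<and> (\<forall>a\<in>G. \<forall>h\<in>H. gyr a h ` H = H)"

locale topological_gyrogroup = gyrogroup "topspace T" add zero neg gyr
  for T :: "'a topology"
    and add :: "'a \<Rightarrow> 'a \<Rightarrow> 'a" (infixl "\<oplus>" 65)
    and zero :: 'a ("\<zero>")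
    and neg :: "'a \<Rightarrow> 'a" ("\<ominus> _" [81] 80)
    and gyr :: "'a \<Rightarrow> 'a \<Rightarrow> 'a \<Rightarrow> 'a" +
  assumes Hausdorff: "Hausdorff_space T"
    and continuous_add: "continuous_map (prod_topology T T) T (\<lambda>(x, y). x \<oplus> y)"
    and continuous_neg: "continuous_map T T neg"

section \<open>The coset space\<close>

definition left_coset :: "('a \<Rightarrow> 'a \<Rightarrow> 'a) \<Rightarrow> 'a set \<Rightarrow> 'a \<Rightarrow> 'a set" where
  "left_coset add H a = add a ` H"

definition coset_topology :: "'a topology \<Rightarrow> ('a \<Rightarrow> 'a \<Rightarrow> 'a) \<Rightarrow> 'a set \<Rightarrow> 'a set topology" where
  "coset_topology T add H = topology (\<lambda>U.
     U \<subseteq> left_coset add H ` topspace T \<and>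
     openin T {a \<in> topspace T. left_coset add H a \<in> U})"

lemma openin_coset_topology:
  "openin (coset_topology T add H) U \<longleftrightarrow>
     U \<subseteq> left_coset add H ` topspace T \<and>
     openin T {a \<in> topspace T. left_coset add H a \<in> U}"
proof -
  let ?p = "left_coset add H"
  let ?L = "\<lambda>U. U \<subseteq> ?p ` topspace T \<and> openin T {a \<in> topspace T. ?p a \<in> U}"
  have "istopology ?L"
    unfolding istopology_def
  proof (intro conjI allI impI)
    fix S S' assume "?L S" "?L S'"
    moreover have "{a \<in> topspace T. ?p a \<in> S \<inter> S'} =
        {a \<in> topspace T. ?p a \<in> S} \<inter> {a \<in> topspace T. ?p a \<in> S'}"
      by auto
    ultimately show "S \<inter> S' \<subseteq> ?p ` topspace T"
      and "openin T {a \<in> topspace T. ?p a \<in> S \<inter> S'}"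
      by auto
  next
    fix \<K> assume *: "\<forall>K\<in>\<K>. ?L K"
    then show "\<Union>\<K> \<subseteq> ?p ` topspace T"
      by auto
    have "{a \<in> topspace T. ?p a \<in> \<Union>\<K>} = (\<Union>K\<in>\<K>. {a \<in> topspace T. ?p a \<in> K})"
      by auto
    then show "openin T {a \<in> topspace T. ?p a \<in> \<Union>\<K>}"
      using * by auto
  qed
  then show ?thesis
    by (simp add: coset_topology_def)
qed

lemma topspace_coset_topology:
  "topspace (coset_topology T add H) = left_coset add H ` topspace T"
proof -
  have "{a \<in> topspace T. left_coset add H a \<in> left_coset add H ` topspace T} = topspace T"
    by auto
  then have "openin (coset_topology T add H) (left_coset add H ` topspace T)"
    unfolding openin_coset_topology by simp
  then show ?thesis
    by (metis openin_coset_topology openin_subset openin_topspace subset_antisym)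
qed

lemma quotient_map_coset_topology:
  "quotient_map T (coset_topology T add H) (left_coset add H)"
  by (auto simp: quotient_map_def openin_coset_topology topspace_coset_topology)

section \<open>Compactness properties\<close>

text \<open>\<open>countably_compactin\<close> and \<open>sequentially_compactin\<close> are to \<^const>\<open>countably_compact\<close>
  and \<^const>\<open>seq_compact\<close> what \<^const>\<open>compactin\<close> is to \<^const>\<open>compact\<close>.\<close>

definition countably_compactin :: "'a topology \<Rightarrow> 'a set \<Rightarrow> bool" where
  "countably_compactin X S \<longleftrightarrow>
     S \<subseteq> topspace X \<and>
     (\<forall>\<U>. countable \<U> \<and> (\<forall>U\<in>\<U>. openin X U) \<and> S \<subseteq> \<Union>\<U>
        \<longrightarrow> (\<exists>\<F>. finite \<F> \<and> \<F> \<subseteq> \<U> \<and> S \<subseteq> \<Union>\<F>))"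

definition sequentially_compactin :: "'a topology \<Rightarrow> 'a set \<Rightarrow> bool" where
  "sequentially_compactin X S \<longleftrightarrow>
     S \<subseteq> topspace X \<and>
     (\<forall>f::nat \<Rightarrow> 'a. (\<forall>n. f n \<in> S)
        \<longrightarrow> (\<exists>l\<in>S. \<exists>r::nat \<Rightarrow> nat. strict_mono r \<and> limitin X (f \<circ> r) l sequentially))"

lemma countably_compactin_euclidean: "countably_compactin euclidean S \<longleftrightarrow> countably_compact S"
  unfolding countably_compactin_def countably_compact_def by simp metis

lemma sequentially_compactin_euclidean: "sequentially_compactin euclidean S \<longleftrightarrow> seq_compact S"
  unfolding sequentially_compactin_def seq_compact_def by simp

text \<open>One choice of property has to be applied to topologies on different types (the gyrogroup
  and its coset space), so it is represented by a name rather than by a predicate variable.\<close>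

datatype compactness = Compact | Countably_Compact | Sequentially_Compact

fun kappa_in :: "compactness \<Rightarrow> 'a topology \<Rightarrow> 'a set \<Rightarrow> bool" where
  "kappa_in Compact X S \<longleftrightarrow> compactin X S"
| "kappa_in Countably_Compact X S \<longleftrightarrow> countably_compactin X S"
| "kappa_in Sequentially_Compact X S \<longleftrightarrow> sequentially_compactin X S"

section \<open>Frechet-Urysohn properties\<close>

definition strictly_Frechet_Urysohn :: "'a topology \<Rightarrow> bool" where
  "strictly_Frechet_Urysohn X \<longleftrightarrow>
     (\<forall>x \<in> topspace X. \<forall>A::nat \<Rightarrow> 'a set.
        (\<forall>n. A n \<subseteq> topspace X) \<and> x \<in> (\<Inter>n. X closure_of A n)
        \<longrightarrow> (\<exists>f. (\<forall>n. f n \<in> A n) \<and> limitin X f x sequentially))"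

definition strongly_Frechet_Urysohn :: "'a topology \<Rightarrow> bool" where
  "strongly_Frechet_Urysohn X \<longleftrightarrow>
     (\<forall>x \<in> topspace X. \<forall>A::nat \<Rightarrow> 'a set.
        (\<forall>n. A n \<subseteq> topspace X) \<and> decseq A \<and> x \<in> (\<Inter>n. X closure_of A n)
        \<longrightarrow> (\<exists>f. (\<forall>n. f n \<in> A n) \<and> limitin X f x sequentially))"

end

theory Submission
  imports Defs
begin

text \<open>Let \<open>K\<close> be a \<open>\<kappa>\<close> subset of the gyrogroup and \<open>x \<in> K\<close>. Left translation by \<open>\<ominus> x\<close> moves
  \<open>K \<inter> (x \<oplus> H)\<close> to a \<open>\<kappa>\<close> subset of \<open>H\<close>, so this fibre is first-countable, and as the gyrogroup is
  regular there are decreasing open neighbourhoods \<open>V n\<close> of \<open>x\<close> whose closures meet the fibre jointly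
  in \<open>x\<close> only. A sequence \<open>f n \<in> K \<inter> V n\<close> whose projection converges to that of \<open>x\<close> has \<open>x\<close> as its only
  cluster point, because the coset space is Hausdorff, and hence converges to \<open>x\<close> by countable
  compactness of \<open>K\<close>. It remains to apply the hypothesis on the projection of \<open>K\<close> to the
  projections of the sets \<open>A n \<inter> V n\<close>.\<close>

section \<open>Compactness properties\<close>

lemma kappa_in_subset: "kappa_in \<kappa> X K \<Longrightarrow> K \<subseteq> topspace X"
  by (cases \<kappa>) (auto simp: compactin_def countably_compactin_def sequentially_compactin_def)

lemma countably_compactinE:
  assumes "countably_compactin X K" "countable \<U>" "\<forall>U\<in>\<U>. openin X U" "K \<subseteq> \<Union>\<U>"
  obtains \<F> where "finite \<F>" "\<F> \<subseteq> \<U>" "K \<subseteq> \<Union>\<F>"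
proof -
  have "\<exists>\<F>. finite \<F> \<and> \<F> \<subseteq> \<U> \<and> K \<subseteq> \<Union>\<F>"
    using assms(1)[unfolded countably_compactin_def, THEN conjunct2, rule_format, of \<U>] assms(2-4)
    by simp
  then show thesis
    by (elim exE conjE) (rule that)
qed

section \<open>Closed subsets and continuous images of \<kappa> sets\<close>

lemma countably_compactin_Int_closedin:
  assumes "countably_compactin X K" "closedin X C"
  shows "countably_compactin X (K \<inter> C)"
  unfolding countably_compactin_def
proof (intro conjI allI impI)
  show "K \<inter> C \<subseteq> topspace X"
    using assms by (auto simp: countably_compactin_def)
  fix \<U> assume \<U>: "countable \<U> \<and> (\<forall>U\<in>\<U>. openin X U) \<and> K \<inter> C \<subseteq> \<Union>\<U>"
  have "countable (insert (topspace X - C) \<U>)"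
       "\<forall>U\<in>insert (topspace X - C) \<U>. openin X U"
       "K \<subseteq> \<Union>(insert (topspace X - C) \<U>)"
    using assms \<U> by (auto simp: countably_compactin_def)
  then obtain \<F> where "finite \<F>" "\<F> \<subseteq> insert (topspace X - C) \<U>" "K \<subseteq> \<Union>\<F>"
    by (rule countably_compactinE[OF assms(1)])
  then have "finite (\<F> - {topspace X - C}) \<and> \<F> - {topspace X - C} \<subseteq> \<U>
      \<and> K \<inter> C \<subseteq> \<Union>(\<F> - {topspace X - C})"
    by blast
  then show "\<exists>\<F>. finite \<F> \<and> \<F> \<subseteq> \<U> \<and> K \<inter> C \<subseteq> \<Union>\<F>"
    by blast
qed

lemma sequentially_compactin_Int_closedin:
  assumes "sequentially_compactin X K" "closedin X C"
  shows "sequentially_compactin X (K \<inter> C)"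
  unfolding sequentially_compactin_def
proof (intro conjI allI impI)
  show "K \<inter> C \<subseteq> topspace X"
    using assms by (auto simp: sequentially_compactin_def)
  fix f :: "nat \<Rightarrow> 'a" assume f: "\<forall>n. f n \<in> K \<inter> C"
  then obtain l r where "l \<in> K" "strict_mono (r :: nat \<Rightarrow> nat)"
      and lim: "limitin X (f \<circ> r) l sequentially"
    using assms(1) unfolding sequentially_compactin_def by blast
  moreover have "l \<in> C"
    using limitin_closedin[OF lim assms(2)] f by simp
  ultimately show "\<exists>l\<in>K \<inter> C. \<exists>r::nat \<Rightarrow> nat. strict_mono r \<and> limitin X (f \<circ> r) l sequentially"
    by blast
qed

lemma kappa_in_Int_closedin:
  assumes "kappa_in \<kappa> X K" "closedin X C"
  shows "kappa_in \<kappa> X (K \<inter> C)"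
  using assms
  by (cases \<kappa>) (simp_all add: compact_Int_closedin countably_compactin_Int_closedin
      sequentially_compactin_Int_closedin)

lemma countably_compactin_image:
  assumes "countably_compactin X K" "continuous_map X Y f"
  shows "countably_compactin Y (f ` K)"
  unfolding countably_compactin_def
proof (intro conjI allI impI)
  show "f ` K \<subseteq> topspace Y"
    using assms by (auto simp: countably_compactin_def continuous_map_def)
  fix \<U> assume \<U>: "countable \<U> \<and> (\<forall>U\<in>\<U>. openin Y U) \<and> f ` K \<subseteq> \<Union>\<U>"
  let ?P = "\<lambda>U. {x \<in> topspace X. f x \<in> U}"
  have "countable (?P ` \<U>)" "\<forall>U\<in>?P ` \<U>. openin X U" "K \<subseteq> \<Union>(?P ` \<U>)"
  proof -
    show "K \<subseteq> \<Union>(?P ` \<U>)"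
    proof
      fix x assume "x \<in> K"
      then have "f x \<in> \<Union>\<U>" "x \<in> topspace X"
        using \<U> assms(1) by (auto simp: countably_compactin_def)
      then show "x \<in> \<Union>(?P ` \<U>)"
        by auto
    qed
  qed (use assms(2) \<U> in \<open>auto simp: continuous_map_def\<close>)
  then obtain \<F> where \<F>: "finite \<F>" "\<F> \<subseteq> ?P ` \<U>" "K \<subseteq> \<Union>\<F>"
    by (rule countably_compactinE[OF assms(1)])
  then obtain \<G> where "finite \<G>" "\<G> \<subseteq> \<U>" "\<F> = ?P ` \<G>"
    using finite_subset_image[OF \<F>(1,2)] by blast
  then show "\<exists>\<F>. finite \<F> \<and> \<F> \<subseteq> \<U> \<and> f ` K \<subseteq> \<Union>\<F>"
    using \<F>(3) by (intro exI[of _ \<G>]) auto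
qed

lemma sequentially_compactin_image:
  assumes "sequentially_compactin X K" "continuous_map X Y f"
  shows "sequentially_compactin Y (f ` K)"
  unfolding sequentially_compactin_def
proof (intro conjI allI impI)
  show "f ` K \<subseteq> topspace Y"
    using assms by (auto simp: sequentially_compactin_def continuous_map_def)
  fix g :: "nat \<Rightarrow> 'b" assume "\<forall>n. g n \<in> f ` K"
  then have "\<forall>n. \<exists>y. y \<in> K \<and> g n = f y"
    by blast
  then obtain h where h: "\<And>n. h n \<in> K" "\<And>n. g n = f (h n)"
    by metis
  then obtain l r where "l \<in> K" "strict_mono (r :: nat \<Rightarrow> nat)"
      and lim: "limitin X (h \<circ> r) l sequentially"
    using assms(1) unfolding sequentially_compactin_def by blast
  moreover have "limitin Y (g \<circ> r) (f l) sequentially"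
    using continuous_map_limit[OF assms(2) lim] h(2) by (simp add: o_def)
  ultimately show "\<exists>l\<in>f ` K. \<exists>r::nat \<Rightarrow> nat. strict_mono r \<and> limitin Y (g \<circ> r) l sequentially"
    by blast
qed

lemma kappa_in_image:
  assumes "kappa_in \<kappa> X K" "continuous_map X Y f"
  shows "kappa_in \<kappa> Y (f ` K)"
  using assms
  by (cases \<kappa>) (simp_all add: image_compactin countably_compactin_image
      sequentially_compactin_image)

text \<open>Without a cluster point in \<open>K\<close>, every point of \<open>K\<close> has a
  neighbourhood missed by a tail of the sequence. Merging these neighbourhoods according to where
  the tail begins leaves only countably many open sets, so countable compactness applies.\<close>

lemma countably_compactin_cluster_point:
  assumes "countably_compactin X K" "\<And>n::nat. f n \<in> K"
  shows "\<exists>l\<in>K. \<forall>U. openin X U \<and> l \<in> U \<longrightarrow> (\<exists>\<^sub>F n in sequentially. f n \<in> U)"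
proof (rule ccontr)
  assume "\<not> ?thesis"
  then have no: "\<forall>l\<in>K. \<exists>U N. openin X U \<and> l \<in> U \<and> (\<forall>n\<ge>N. f n \<notin> U)"
    by (simp add: not_frequently eventually_sequentially)
  define W where "W = (\<lambda>N. \<Union>{U. openin X U \<and> (\<forall>n\<ge>N. f n \<notin> U)})"
  have "K \<subseteq> \<Union>(range W)"
  proof
    fix l assume "l \<in> K"
    then obtain U N where "openin X U" "l \<in> U" "\<forall>n\<ge>N. f n \<notin> U"
      using no by blast
    then have "l \<in> W N"
      unfolding W_def by blast
    then show "l \<in> \<Union>(range W)"
      by blast
  qed
  moreover have "countable (range W)" "\<forall>U\<in>range W. openin X U"
    by (auto simp: W_def)
  ultimately obtain \<F> where \<F>: "finite \<F>" "\<F> \<subseteq> range W" "K \<subseteq> \<Union>\<F>"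
    using countably_compactinE[OF assms(1), of "range W"] by blast
  then obtain I where I: "finite I" "K \<subseteq> \<Union>(W ` I)"
    using finite_subset_image[OF \<F>(1,2)] by blast
  \<comment> \<open>This term belongs to every tail starting at some \<open>N \<in> I\<close>, so no
    such \<open>W N\<close> contains it. The inserted \<open>0\<close> gives \<open>Max\<close> a
    nonempty set.\<close>
  have "f (Max (insert 0 I)) \<in> K"
    by (rule assms(2))
  then obtain N where N: "N \<in> I" "f (Max (insert 0 I)) \<in> W N"
    using I(2) by blast
  then have "N \<le> Max (insert 0 I)"
    using I(1) by simp
  then show False
    using N(2) by (auto simp: W_def)
qed

text \<open>What the three choices of \<kappa> share: the limit of a convergent subsequence is a
  cluster point in the sequential case, and the other two cases reduce to countable
  compactness.\<close>

lemma kappa_in_cluster_point: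
  assumes "kappa_in \<kappa> X K" "\<And>n::nat. f n \<in> K"
  obtains l where "l \<in> K" "\<And>U. \<lbrakk>openin X U; l \<in> U\<rbrakk> \<Longrightarrow> \<exists>\<^sub>F n in sequentially. f n \<in> U"
proof (cases "\<kappa> = Sequentially_Compact")
  case True
  then obtain l r where lr: "l \<in> K" "strict_mono (r :: nat \<Rightarrow> nat)"
      "limitin X (f \<circ> r) l sequentially"
    using assms unfolding True kappa_in.simps sequentially_compactin_def by blast
  show ?thesis
  proof (rule that)
    fix U assume "openin X U" "l \<in> U"
    then obtain N where N: "\<And>n. n \<ge> N \<Longrightarrow> f (r n) \<in> U"
      using lr(3) by (auto simp: limitin_sequentially)
    show "\<exists>\<^sub>F n in sequentially. f n \<in> U"
      unfolding frequently_sequentially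
    proof
      fix M
      show "\<exists>n\<ge>M. f n \<in> U"
        \<comment> \<open>The index \<open>r (max M N)\<close> works, since a strictly increasing
          \<open>r\<close> satisfies \<open>k \<le> r k\<close>.\<close>
        using N[of "max M N"] seq_suble[OF lr(2), of "max M N"]
        by (meson le_trans max.cobounded1 max.cobounded2)
    qed
  qed (fact lr(1))
next
  case False
  then have "countably_compactin X K"
    using assms(1) by (cases \<kappa>) (auto simp: compactin_def countably_compactin_def)
  then show ?thesis
    using countably_compactin_cluster_point[of X K f] assms(2) that by blast
qed

section \<open>Lifting convergence along a map with first-countable fibres\<close>

text \<open>A countable base at \<open>x\<close> within \<open>S\<close> consists of traces on
  \<open>S\<close> of open sets. Regularity shrinks these to open sets of \<open>X\<close> whose
  closures still trace inside the base, and the Hausdorff property leaves only \<open>x\<close> in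
  all the traces.\<close>

lemma first_countable_regular_neighbourhoods:
  assumes "regular_space X" "Hausdorff_space X" "x \<in> S" "S \<subseteq> topspace X"
    and "first_countable (subtopology X S)"
  obtains V :: "nat \<Rightarrow> 'a set"
  where "decseq V" "\<And>n. openin X (V n)" "\<And>n. x \<in> V n" "S \<inter> (\<Inter>n. X closure_of V n) \<subseteq> {x}"
proof -
  have x: "x \<in> topspace (subtopology X S)"
    using assms by auto
  then obtain \<B> where \<B>: "countable \<B>" "\<And>B. B \<in> \<B> \<Longrightarrow> openin (subtopology X S) B"
      and base: "\<And>U. \<lbrakk>openin (subtopology X S) U; x \<in> U\<rbrakk> \<Longrightarrow> \<exists>B\<in>\<B>. x \<in> B \<and> B \<subseteq> U"
    using assms(5) unfolding first_countable_def by metis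
  \<comment> \<open>Enumerates, possibly with repetitions, the base members containing
    \<open>x\<close>; all are reached because there is at least one.\<close>
  define b where "b = from_nat_into {B \<in> \<B>. x \<in> B}"
  have "{B \<in> \<B>. x \<in> B} \<noteq> {}"
    using base[OF openin_topspace x] by blast
  then have b: "range b = {B \<in> \<B>. x \<in> B}"
    unfolding b_def using \<B>(1) by (intro range_from_nat_into) auto
  have "\<exists>V. openin X V \<and> x \<in> V \<and> S \<inter> X closure_of V \<subseteq> b n" for n
  proof -
    have "openin (subtopology X S) (b n)" "x \<in> b n"
      using b \<B>(2) by auto
    then obtain W where W: "openin X W" "b n = W \<inter> S" "x \<in> W"
      by (auto simp: openin_subtopology)
    then obtain U C where "openin X U" "closedin X C" "x \<in> U" "U \<subseteq> C" "C \<subseteq> W"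
      using assms(1) unfolding neighbourhood_base_of_closedin[symmetric] neighbourhood_base_of
      by metis
    then show ?thesis
      using closure_of_minimal[of U C X] W(2) by blast
  qed
  then obtain V where V: "\<And>n. openin X (V n)" "\<And>n. x \<in> V n" "\<And>n. S \<inter> X closure_of V n \<subseteq> b n"
    by metis
  show ?thesis
  proof (rule that)
    show "decseq (\<lambda>n. \<Inter>i\<le>n. V i)"
      by (auto simp: decseq_def)
    show "openin X (\<Inter>i\<le>n. V i)" for n
      using V(1) by (intro openin_Inter) auto
    show "x \<in> (\<Inter>i\<le>n. V i)" for n
      using V(2) by simp
    show "S \<inter> (\<Inter>n. X closure_of (\<Inter>i\<le>n. V i)) \<subseteq> {x}"
    proof
      fix y assume y: "y \<in> S \<inter> (\<Inter>n. X closure_of (\<Inter>i\<le>n. V i))"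
      have "y \<in> X closure_of V n" for n
        using y closure_of_mono[of "\<Inter>i\<le>n. V i" "V n" X] by auto
      then have yb: "y \<in> b n" for n
        using y V(3) by blast
      show "y \<in> {x}"
      proof (rule ccontr)
        assume "y \<notin> {x}"
        \<comment> \<open>A base member inside \<open>U \<inter> S\<close> is some
          \<open>b n\<close> and so contains \<open>y\<close>, although \<open>W\<close> separates
          \<open>y\<close> from \<open>U\<close>.\<close>
        then obtain U W where UW: "openin X U" "openin X W" "x \<in> U" "y \<in> W" "disjnt U W"
          using assms(2-4) y unfolding Hausdorff_space_def by (metis IntD1 singletonI subsetD)
        then obtain B where "B \<in> \<B>" "x \<in> B" "B \<subseteq> U \<inter> S"
          using base[of "U \<inter> S"] assms(3) by (auto simp: openin_subtopology)
        then have "y \<in> U"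
          using yb b by blast
        then show False
          using UW by (auto simp: disjnt_iff)
      qed
    qed
  qed
qed

text \<open>The neighbourhoods depend on \<open>x\<close> and \<open>K\<close> but not on
  \<open>f\<close>, so they can be fixed before the points \<open>f n\<close> are selected in them.
  If \<open>f\<close> failed to converge, a subsequence avoiding some neighbourhood of
  \<open>x\<close> would have a cluster point in \<open>K\<close>; it is forced into the fibre of
  \<open>x\<close> and into the closure of every \<open>V m\<close>, hence equals
  \<open>x\<close>.\<close>

lemma limitin_if_fibre_first_countable:
  assumes "regular_space X" "Hausdorff_space X" "Hausdorff_space Y" "continuous_map X Y p"
    and "kappa_in \<kappa> X K" "x \<in> K"
    and "first_countable (subtopology X (K \<inter> {y \<in> topspace X. p y = p x}))"
  obtains V :: "nat \<Rightarrow> 'a set"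
  where "decseq V" "\<And>n. openin X (V n)" "\<And>n. x \<in> V n"
    "\<And>f. \<lbrakk>\<And>n. f n \<in> K \<inter> V n; limitin Y (p \<circ> f) (p x) sequentially\<rbrakk>
      \<Longrightarrow> limitin X f x sequentially"
proof -
  have KX: "K \<subseteq> topspace X"
    using assms(5) by (rule kappa_in_subset)
  obtain V :: "nat \<Rightarrow> 'a set" where V: "decseq V" "\<And>n. openin X (V n)" "\<And>n. x \<in> V n"
      "K \<inter> {y \<in> topspace X. p y = p x} \<inter> (\<Inter>n. X closure_of V n) \<subseteq> {x}"
    using first_countable_regular_neighbourhoods[OF assms(1,2) _ _ assms(7), of x] assms(6) KX
    by blast
  show ?thesis
  proof (rule that)
    fix f assume f: "\<And>n. f n \<in> K \<inter> V n" and lim: "limitin Y (p \<circ> f) (p x) sequentially"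
    show "limitin X f x sequentially"
      unfolding limitin_def
    proof (intro conjI allI impI)
      show "x \<in> topspace X"
        using assms(6) KX by blast
      fix U assume U: "openin X U \<and> x \<in> U"
      show "\<forall>\<^sub>F n in sequentially. f n \<in> U"
      proof (rule ccontr)
        assume "\<not> (\<forall>\<^sub>F n in sequentially. f n \<in> U)"
        then obtain r where r: "strict_mono (r :: nat \<Rightarrow> nat)" "\<And>n. f (r n) \<notin> U"
          using not_eventually_sequentiallyD by blast
        obtain y where y: "y \<in> K"
            and cluster: "\<And>W. \<lbrakk>openin X W; y \<in> W\<rbrakk> \<Longrightarrow> \<exists>\<^sub>F n in sequentially. f (r n) \<in> W"
          using kappa_in_cluster_point[OF assms(5), of "\<lambda>n. f (r n)"] f by blast
        \<comment> \<open>Otherwise disjoint neighbourhoods of the two points would contain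
          \<open>p (f (r n))\<close> infinitely often and eventually, respectively.\<close>
        have "p y = p x"
        proof (rule ccontr)
          assume "p y \<noteq> p x"
          moreover have "p x \<in> topspace Y" "p y \<in> topspace Y"
            using assms(4,6) y KX by (auto simp: continuous_map_def)
          ultimately obtain A B where AB: "openin Y A" "openin Y B" "p y \<in> A" "p x \<in> B" "disjnt A B"
            using assms(3) unfolding Hausdorff_space_def by metis
          have "\<exists>\<^sub>F n in sequentially. f (r n) \<in> {z \<in> topspace X. p z \<in> A}"
            using cluster openin_continuous_map_preimage[OF assms(4) AB(1)] AB(3) y KX by blast
          moreover have "\<forall>\<^sub>F n in sequentially. p (f (r n)) \<in> B"
            using limitin_subsequence[OF r(1) lim] AB(2,4) by (simp add: limitin_def)
          ultimately have ev: "\<exists>\<^sub>F n in sequentially. f (r n) \<in> {z \<in> topspace X. p z \<in> A} \<and> p (f (r n)) \<in> B"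
            using frequently_eventually_frequently by force
          show False
            using AB(5) frequently_ex[OF ev] by (auto simp: disjnt_iff)
        qed
        moreover have "y \<in> X closure_of V m" for m
          unfolding in_closure_of
        proof (intro conjI allI impI)
          show "y \<in> topspace X"
            using y KX by blast
          fix W assume "y \<in> W \<and> openin X W"
          then obtain n where "n \<ge> m" "f (r n) \<in> W"
            using cluster unfolding frequently_sequentially by metis
          \<comment> \<open>Here \<open>m \<le> n \<le> r n\<close>, so
            \<open>V (r n) \<subseteq> V m\<close>.\<close>
          moreover have "f (r n) \<in> V m"
            using f[of "r n"] decseqD[OF V(1), of m "r n"] seq_suble[OF r(1), of n] \<open>n \<ge> m\<close> by auto
          ultimately show "\<exists>z. z \<in> V m \<and> z \<in> W"
            by blast
        qed
        ultimately have "y = x"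
          using V(4) y KX by blast
        then show False
          using cluster[of U] U r(2) by (auto simp: frequently_def)
      qed
    qed
  qed (use V in auto)
qed

text \<open>As \<open>V\<close> is a neighbourhood of \<open>x\<close>, cutting \<open>A\<close>
  down to \<open>V\<close> keeps \<open>x\<close> in the closure, and continuity carries this to the
  image.\<close>

lemma image_closure_of_Int_openin:
  assumes "continuous_map X Y p" "A \<subseteq> K" "openin X V" "x \<in> V"
    and "x \<in> subtopology X K closure_of A"
  shows "p x \<in> subtopology Y (p ` K) closure_of (p ` (A \<inter> V))"
proof -
  have "x \<in> K" "x \<in> X closure_of A"
    using assms(2,5) by (auto simp: closure_of_subtopology Int_absorb1)
  then have "p x \<in> Y closure_of (p ` (A \<inter> V))"
    using openin_Int_closure_of_subset[OF assms(3), of A] assms(4)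
      continuous_map_image_closure_subset[OF assms(1), of "A \<inter> V"]
    by (auto simp: Int_commute)
  moreover have "p ` K \<inter> p ` (A \<inter> V) = p ` (A \<inter> V)"
    using assms(2) by auto
  ultimately show ?thesis
    using \<open>x \<in> K\<close> by (simp add: closure_of_subtopology)
qed

text \<open>The property of the image is applied to the projections of
  \<open>A n \<inter> V n\<close>. Each chosen point has a preimage in
  \<open>A n \<inter> V n\<close>, and these preimages converge by the choice of
  \<open>V\<close>.\<close>

lemma strongly_Frechet_Urysohn_lift:
  assumes "regular_space X" "Hausdorff_space X" "Hausdorff_space Y" "continuous_map X Y p"
    and "kappa_in \<kappa> X K"
    and fib: "\<And>x. x \<in> K \<Longrightarrow> first_countable (subtopology X (K \<inter> {y \<in> topspace X. p y = p x}))"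
    and "strongly_Frechet_Urysohn (subtopology Y (p ` K))"
  shows "strongly_Frechet_Urysohn (subtopology X K)"
  unfolding strongly_Frechet_Urysohn_def
proof (intro ballI allI impI, elim conjE)
  fix x and A :: "nat \<Rightarrow> 'a set"
  assume "x \<in> topspace (subtopology X K)" and A: "\<forall>n. A n \<subseteq> topspace (subtopology X K)" "decseq A"
    and cl: "x \<in> (\<Inter>n. subtopology X K closure_of A n)"
  then have "x \<in> K"
    by simp
  then obtain V :: "nat \<Rightarrow> 'a set" where V: "decseq V" "\<And>n. openin X (V n)" "\<And>n. x \<in> V n"
      and lift: "\<And>f. \<lbrakk>\<And>n. f n \<in> K \<inter> V n; limitin Y (p \<circ> f) (p x) sequentially\<rbrakk>
        \<Longrightarrow> limitin X f x sequentially"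
    using limitin_if_fibre_first_countable[OF assms(1-5) _ fib] by metis
  have YK: "topspace (subtopology Y (p ` K)) = p ` K"
    using kappa_in_subset[OF assms(5)] assms(4) by (auto simp: continuous_map_def)
  have "p x \<in> (\<Inter>n. subtopology Y (p ` K) closure_of (p ` (A n \<inter> V n)))"
    using image_closure_of_Int_openin[OF assms(4) _ V(2,3), of "A _" K] A(1) cl by simp
  \<comment> \<open>Monotonicity of both \<open>A\<close> and \<open>V\<close> brings the projected
    sets under the strong property.\<close>
  moreover have "decseq (\<lambda>n. p ` (A n \<inter> V n))"
    using A(2) V(1) unfolding decseq_def by (meson Int_mono image_mono)
  moreover have "\<forall>n. p ` (A n \<inter> V n) \<subseteq> p ` K"
    using A(1) by auto
  ultimately obtain g where g: "\<And>n. g n \<in> p ` (A n \<inter> V n)"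
      "limitin (subtopology Y (p ` K)) g (p x) sequentially"
    using assms(7)[unfolded strongly_Frechet_Urysohn_def YK, rule_format,
        of "p x" "\<lambda>n. p ` (A n \<inter> V n)"] \<open>x \<in> K\<close> by blast
  then have "\<forall>n. \<exists>y. y \<in> A n \<inter> V n \<and> g n = p y"
    by blast
  then obtain f where f: "\<And>n. f n \<in> A n \<inter> V n" "\<And>n. g n = p (f n)"
    by metis
  then have "g = p \<circ> f"
    by auto
  then have "limitin X f x sequentially"
    using g(2) f(1) A(1) by (intro lift) (auto simp: limitin_subtopology)
  then show "\<exists>f. (\<forall>n. f n \<in> A n) \<and> limitin (subtopology X K) f x sequentially"
    using f(1) A(1) \<open>x \<in> K\<close>
    by (intro exI[of _ f]) (auto simp: limitin_subtopology subset_iff intro!: always_eventually)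
qed

text \<open>The argument of the strong case carries over, the strict property being applied to the
  same projected sets.\<close>

lemma strictly_Frechet_Urysohn_lift:
  assumes "regular_space X" "Hausdorff_space X" "Hausdorff_space Y" "continuous_map X Y p"
    and "kappa_in \<kappa> X K"
    and fib: "\<And>x. x \<in> K \<Longrightarrow> first_countable (subtopology X (K \<inter> {y \<in> topspace X. p y = p x}))"
    and "strictly_Frechet_Urysohn (subtopology Y (p ` K))"
  shows "strictly_Frechet_Urysohn (subtopology X K)"
  unfolding strictly_Frechet_Urysohn_def
proof (intro ballI allI impI, elim conjE)
  fix x and A :: "nat \<Rightarrow> 'a set"
  assume "x \<in> topspace (subtopology X K)" and A: "\<forall>n. A n \<subseteq> topspace (subtopology X K)"
    and cl: "x \<in> (\<Inter>n. subtopology X K closure_of A n)"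
  then have "x \<in> K"
    by simp
  then obtain V :: "nat \<Rightarrow> 'a set" where V: "\<And>n. openin X (V n)" "\<And>n. x \<in> V n"
      and lift: "\<And>f. \<lbrakk>\<And>n. f n \<in> K \<inter> V n; limitin Y (p \<circ> f) (p x) sequentially\<rbrakk>
        \<Longrightarrow> limitin X f x sequentially"
    using limitin_if_fibre_first_countable[OF assms(1-5) _ fib] by metis
  have YK: "topspace (subtopology Y (p ` K)) = p ` K"
    using kappa_in_subset[OF assms(5)] assms(4) by (auto simp: continuous_map_def)
  have "p x \<in> (\<Inter>n. subtopology Y (p ` K) closure_of (p ` (A n \<inter> V n)))"
    using image_closure_of_Int_openin[OF assms(4) _ V, of "A _" K] A cl by simp
  moreover have "\<forall>n. p ` (A n \<inter> V n) \<subseteq> p ` K"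
    using A by auto
  ultimately obtain g where g: "\<And>n. g n \<in> p ` (A n \<inter> V n)"
      "limitin (subtopology Y (p ` K)) g (p x) sequentially"
    using assms(7)[unfolded strictly_Frechet_Urysohn_def YK, rule_format,
        of "p x" "\<lambda>n. p ` (A n \<inter> V n)"] \<open>x \<in> K\<close> by blast
  then have "\<forall>n. \<exists>y. y \<in> A n \<inter> V n \<and> g n = p y"
    by blast
  then obtain f where f: "\<And>n. f n \<in> A n \<inter> V n" "\<And>n. g n = p (f n)"
    by metis
  then have "g = p \<circ> f"
    by auto
  then have "limitin X f x sequentially"
    using g(2) f(1) A by (intro lift) (auto simp: limitin_subtopology)
  then show "\<exists>f. (\<forall>n. f n \<in> A n) \<and> limitin (subtopology X K) f x sequentially"
    using f(1) A \<open>x \<in> K\<close>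
    by (intro exI[of _ f]) (auto simp: limitin_subtopology subset_iff intro!: always_eventually)
qed

section \<open>Gyrogroups and their coset spaces\<close>

context gyrogroup
begin

lemma neg_neg: "x \<in> G \<Longrightarrow> \<ominus> (\<ominus> x) = x"
  using neg_unique[of "\<ominus> x" x] neg_closed neg_left neg_right by simp

text \<open>Uniqueness of gyrations makes \<open>gyr \<zero> a\<close> the identity, and the loop
  property transfers this to \<open>gyr (\<ominus> a) a\<close> because
  \<open>(\<ominus> a) \<oplus> a = \<zero>\<close>.\<close>

lemma neg_add_cancel:
  assumes "a \<in> G" "b \<in> G"
  shows "(\<ominus> a) \<oplus> (a \<oplus> b) = b"
proof -
  have "b = gyr \<zero> a b"
    using assms by (intro gyr_unique) (simp_all add: zero_closed zero_left add_closed)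
  also have "\<dots> = gyr (\<ominus> a) a b"
    using gyr_loop[of "\<ominus> a" a b] assms by (simp add: neg_closed neg_left)
  finally show ?thesis
    using gyr_assoc[of "\<ominus> a" a b] assms by (simp add: neg_closed neg_left zero_left)
qed

lemma add_neg_cancel: "\<lbrakk>a \<in> G; b \<in> G\<rbrakk> \<Longrightarrow> a \<oplus> ((\<ominus> a) \<oplus> b) = b"
  using neg_add_cancel[of "\<ominus> a" b] by (simp add: neg_closed neg_neg)

text \<open>The identity \<open>e\<close> that \<open>H\<close> has as a gyrogroup satisfies
  \<open>e \<oplus> e = e \<oplus> \<zero>\<close>, so left cancellation in \<open>G\<close>
  identifies it with \<open>\<zero>\<close>.\<close>

lemma subgyrogroup_zero_closed:
  assumes "subgyrogroup G (\<oplus>) gyr H"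
  shows "\<zero> \<in> H"
proof -
  obtain e n g where "gyrogroup H (\<oplus>) e n g" and "H \<subseteq> G"
    using assms by (auto simp: subgyrogroup_def)
  then have "e \<in> H" "e \<oplus> e = e \<oplus> \<zero>" "e \<in> G"
    using gyrogroup.zero_closed gyrogroup.zero_left zero_right by (metis subsetD)+
  then have "e = \<zero>"
    using left_cancel[of e e \<zero>] zero_closed by simp
  then show ?thesis
    using \<open>e \<in> H\<close> by simp
qed

text \<open>A preimage of \<open>k \<in> H\<close> is \<open>n h \<oplus> k\<close>, where
  \<open>n\<close> is the inverse operation belonging to \<open>H\<close> itself.\<close>

lemma subgyrogroup_add_image:
  assumes "subgyrogroup G (\<oplus>) gyr H" "h \<in> H"
  shows "(\<oplus>) h ` H = H"
proof -
  obtain e n g where "gyrogroup H (\<oplus>) e n g"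
    using assms by (auto simp: subgyrogroup_def)
  then interpret H: gyrogroup H "(\<oplus>)" e n g .
  show ?thesis
  proof
    show "(\<oplus>) h ` H \<subseteq> H"
      using assms(2) H.add_closed by blast
    show "H \<subseteq> (\<oplus>) h ` H"
      using H.add_neg_cancel[OF assms(2)] H.add_closed[OF H.neg_closed[OF assms(2)]]
      by (metis image_eqI subsetI)
  qed
qed

text \<open>In \<open>a \<oplus> (h \<oplus> k) = (a \<oplus> h) \<oplus> gyr a h k\<close>, as
  \<open>k\<close> runs through \<open>H\<close>, so does \<open>h \<oplus> k\<close>, and so does
  \<open>gyr a h k\<close> by the L-property.\<close>

lemma left_coset_add:
  assumes H: "L_subgyrogroup G (\<oplus>) gyr H" and a: "a \<in> G" and h: "h \<in> H"
  shows "left_coset (\<oplus>) H (a \<oplus> h) = left_coset (\<oplus>) H a"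
proof -
  have HG: "H \<subseteq> G" and gyrH: "gyr a h ` H = H" and sub: "subgyrogroup G (\<oplus>) gyr H"
    using H a h by (auto simp: L_subgyrogroup_def subgyrogroup_def)
  have "left_coset (\<oplus>) H (a \<oplus> h) = (\<lambda>k. (a \<oplus> h) \<oplus> gyr a h k) ` H"
    unfolding left_coset_def by (subst gyrH[symmetric]) (simp add: image_image)
  also have "\<dots> = (\<lambda>k. a \<oplus> (h \<oplus> k)) ` H"
    using gyr_assoc[OF a] HG h by (intro image_cong) (auto simp: subset_iff)
  also have "\<dots> = left_coset (\<oplus>) H a"
    unfolding left_coset_def by (subst (2) subgyrogroup_add_image[OF sub h, symmetric]) (simp add: image_image)
  finally show ?thesis .
qed

text \<open>Reduces equality of cosets to membership of one continuous expression in
  \<open>H\<close>, which is how closedness of \<open>H\<close> is exploited below.\<close>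

lemma left_coset_eq_iff:
  assumes H: "L_subgyrogroup G (\<oplus>) gyr H" and "a \<in> G" "b \<in> G"
  shows "left_coset (\<oplus>) H b = left_coset (\<oplus>) H a \<longleftrightarrow> (\<ominus> a) \<oplus> b \<in> H"
proof
  have sub: "subgyrogroup G (\<oplus>) gyr H" and HG: "H \<subseteq> G"
    using H by (auto simp: L_subgyrogroup_def subgyrogroup_def)
  assume eq: "left_coset (\<oplus>) H b = left_coset (\<oplus>) H a"
  have "b \<in> left_coset (\<oplus>) H b"
    unfolding left_coset_def using subgyrogroup_zero_closed[OF sub] zero_right[OF assms(3)]
    by (metis image_eqI)
  then obtain h where "h \<in> H" "b = a \<oplus> h"
    unfolding eq by (auto simp: left_coset_def)
  then show "(\<ominus> a) \<oplus> b \<in> H"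
    using neg_add_cancel[OF assms(2)] HG by auto
next
  assume "(\<ominus> a) \<oplus> b \<in> H"
  then show "left_coset (\<oplus>) H b = left_coset (\<oplus>) H a"
    using left_coset_add[OF H assms(2)] add_neg_cancel[OF assms(2,3)] by metis
qed

end

lemma openin_prod_topology_rectangle:
  assumes "openin (prod_topology X Y) S" "(x, y) \<in> S"
  obtains U V where "openin X U" "openin Y V" "x \<in> U" "y \<in> V" "U \<times> V \<subseteq> S"
proof -
  have "\<exists>U V. openin X U \<and> openin Y V \<and> x \<in> U \<and> y \<in> V \<and> U \<times> V \<subseteq> S"
    using assms(1)[unfolded openin_prod_topology_alt, rule_format, OF assms(2)] .
  then show thesis
    by (elim exE conjE) (rule that)
qed

section \<open>Topology of a topological gyrogroup and of its coset space\<close>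

context topological_gyrogroup
begin

lemma continuous_map_add:
  assumes "continuous_map X T f" "continuous_map X T g"
  shows "continuous_map X T (\<lambda>x. f x \<oplus> g x)"
  using continuous_map_compose[OF continuous_map_pairedI[OF assms] continuous_add]
  by (simp add: o_def)

lemma continuous_map_neg: "continuous_map X T f \<Longrightarrow> continuous_map X T (\<lambda>x. \<ominus> f x)"
  using continuous_map_compose[OF _ continuous_neg] by (simp add: o_def)

lemma continuous_map_left_translation:
  "a \<in> topspace T \<Longrightarrow> continuous_map T T ((\<oplus>) a)"
  by (rule continuous_map_add) auto

lemma homeomorphic_maps_left_translation:
  assumes "a \<in> topspace T"
  shows "homeomorphic_maps T T ((\<oplus>) a) ((\<oplus>) (\<ominus> a))"
  using assms
  by (simp add: homeomorphic_maps_def continuous_map_left_translation neg_closed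
      neg_add_cancel add_neg_cancel)

text \<open>As for topological groups, with left cancellation in place of associativity: if
  \<open>U \<oplus> N\<close> lies in \<open>W\<close> and \<open>y\<close> is in the closure of
  \<open>U\<close>, some \<open>z \<in> U\<close> has
  \<open>(\<ominus> z) \<oplus> y \<in> N\<close>, and then
  \<open>y = z \<oplus> ((\<ominus> z) \<oplus> y)\<close> is in \<open>W\<close>.\<close>

lemma regular_space: "regular_space T"
  unfolding neighbourhood_base_of_closedin[symmetric] neighbourhood_base_of
proof (intro allI impI, elim conjE)
  fix W x assume W: "openin T W" "x \<in> W"
  then have x: "x \<in> topspace T"
    using openin_subset by blast
  have "openin (prod_topology T T) {z \<in> topspace (prod_topology T T). (\<lambda>(a, b). a \<oplus> b) z \<in> W}"
    by (rule openin_continuous_map_preimage[OF continuous_add W(1)])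
  moreover have "(x, \<zero>) \<in> {z \<in> topspace (prod_topology T T). (\<lambda>(a, b). a \<oplus> b) z \<in> W}"
    using x W(2) by (simp add: zero_closed zero_right)
  ultimately obtain U N where UN: "openin T U" "openin T N" "x \<in> U" "\<zero> \<in> N"
      "U \<times> N \<subseteq> {z \<in> topspace (prod_topology T T). (\<lambda>(a, b). a \<oplus> b) z \<in> W}"
    by (rule openin_prod_topology_rectangle)
  have "T closure_of U \<subseteq> W"
  proof
    fix y assume y: "y \<in> T closure_of U"
    then have yT: "y \<in> topspace T"
      by (simp add: in_closure_of)
    have "continuous_map T T (\<lambda>z. (\<ominus> z) \<oplus> y)"
      using yT by (intro continuous_map_add continuous_map_neg) auto
    then have "openin T {z \<in> topspace T. (\<ominus> z) \<oplus> y \<in> N}"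
      using UN(2) by (rule openin_continuous_map_preimage)
    moreover have "y \<in> {z \<in> topspace T. (\<ominus> z) \<oplus> y \<in> N}"
      using yT UN(4) by (simp add: neg_left)
    ultimately have "\<exists>z. z \<in> U \<and> z \<in> {z \<in> topspace T. (\<ominus> z) \<oplus> y \<in> N}"
      using y[unfolded in_closure_of] by meson
    then obtain z where z: "z \<in> U" "z \<in> topspace T" "(\<ominus> z) \<oplus> y \<in> N"
      by blast
    then have "z \<oplus> ((\<ominus> z) \<oplus> y) \<in> W"
      using UN(5) by auto
    then show "y \<in> W"
      using z(2) yT by (simp add: add_neg_cancel)
  qed
  then show "\<exists>U V. openin T U \<and> closedin T V \<and> x \<in> U \<and> U \<subseteq> V \<and> V \<subseteq> W"
    using UN closure_of_subset[OF openin_subset[OF UN(1)]] closedin_closure_of by metis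
qed

text \<open>The saturation of an open set is a union of its preimages under the continuous right
  translations by elements of \<open>H\<close>.\<close>

lemma open_map_left_coset:
  assumes H: "L_subgyrogroup (topspace T) (\<oplus>) gyr H"
  shows "open_map T (coset_topology T (\<oplus>) H) (left_coset (\<oplus>) H)"
  unfolding open_map_def openin_coset_topology
proof (intro allI impI conjI)
  fix U assume U: "openin T U"
  then have UT: "U \<subseteq> topspace T"
    by (rule openin_subset)
  then show "left_coset (\<oplus>) H ` U \<subseteq> left_coset (\<oplus>) H ` topspace T"
    by blast
  have sub: "subgyrogroup (topspace T) (\<oplus>) gyr H" and HT: "H \<subseteq> topspace T"
    using H by (auto simp: L_subgyrogroup_def subgyrogroup_def)
  have "{a \<in> topspace T. left_coset (\<oplus>) H a \<in> left_coset (\<oplus>) H ` U}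
      = (\<Union>k\<in>H. {a \<in> topspace T. a \<oplus> k \<in> U})"
  proof (intro equalityI subsetI)
    fix a assume "a \<in> {a \<in> topspace T. left_coset (\<oplus>) H a \<in> left_coset (\<oplus>) H ` U}"
    then obtain u where u: "a \<in> topspace T" "u \<in> U" "left_coset (\<oplus>) H u = left_coset (\<oplus>) H a"
      by force
    then have "(\<ominus> a) \<oplus> u \<in> H" "a \<oplus> ((\<ominus> a) \<oplus> u) \<in> U"
      using left_coset_eq_iff[OF H u(1), of u] add_neg_cancel[OF u(1), of u] UT by auto
    then show "a \<in> (\<Union>k\<in>H. {a \<in> topspace T. a \<oplus> k \<in> U})"
      using u(1) by blast
  next
    fix a assume "a \<in> (\<Union>k\<in>H. {a \<in> topspace T. a \<oplus> k \<in> U})"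
    then show "a \<in> {a \<in> topspace T. left_coset (\<oplus>) H a \<in> left_coset (\<oplus>) H ` U}"
      using left_coset_add[OF H] by (auto simp: image_iff)
  qed
  moreover have "openin T {a \<in> topspace T. a \<oplus> k \<in> U}" if "k \<in> H" for k
  proof -
    have "continuous_map T T (\<lambda>a. a \<oplus> k)"
      using that HT by (intro continuous_map_add) auto
    then show ?thesis
      using U by (rule openin_continuous_map_preimage)
  qed
  ultimately show "openin T {a \<in> topspace T. left_coset (\<oplus>) H a \<in> left_coset (\<oplus>) H ` U}"
    by auto
qed

text \<open>As \<open>H\<close> is closed, \<open>(\<ominus> a) \<oplus> b \<notin> H\<close> is an
  open condition on \<open>(a, b)\<close>. It holds on a rectangle \<open>U \<times> V\<close>,
  whose sides have disjoint images, open because the projection is open.\<close>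

lemma Hausdorff_space_coset_topology:
  assumes H: "L_subgyrogroup (topspace T) (\<oplus>) gyr H" and "closedin T H"
  shows "Hausdorff_space (coset_topology T (\<oplus>) H)"
  unfolding Hausdorff_space_def
proof (intro allI impI, elim conjE)
  fix P Q assume "P \<in> topspace (coset_topology T (\<oplus>) H)" "Q \<in> topspace (coset_topology T (\<oplus>) H)"
    and "P \<noteq> Q"
  then obtain a b where ab: "a \<in> topspace T" "b \<in> topspace T"
      "P = left_coset (\<oplus>) H a" "Q = left_coset (\<oplus>) H b"
    unfolding topspace_coset_topology by blast
  then have nH: "(\<ominus> a) \<oplus> b \<notin> H"
    using left_coset_eq_iff[OF H, of a b] \<open>P \<noteq> Q\<close> by blast
  let ?D = "{z \<in> topspace (prod_topology T T). (\<ominus> fst z) \<oplus> snd z \<in> topspace T - H}"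
  have "continuous_map (prod_topology T T) T (\<lambda>z. (\<ominus> fst z) \<oplus> snd z)"
    by (intro continuous_map_add continuous_map_neg continuous_intros)
  then have "openin (prod_topology T T) ?D"
    using assms(2) by (intro openin_continuous_map_preimage) auto
  moreover have "(a, b) \<in> ?D"
    using ab nH by (simp add: add_closed neg_closed)
  ultimately obtain U V where UV: "openin T U" "openin T V" "a \<in> U" "b \<in> V" "U \<times> V \<subseteq> ?D"
    by (rule openin_prod_topology_rectangle)
  have "disjnt (left_coset (\<oplus>) H ` U) (left_coset (\<oplus>) H ` V)"
    unfolding disjnt_iff
  proof (intro allI notI, elim conjE imageE)
    fix R u v assume uv: "R = left_coset (\<oplus>) H u" "u \<in> U" "R = left_coset (\<oplus>) H v" "v \<in> V"
    then have "(\<ominus> u) \<oplus> v \<notin> H" "u \<in> topspace T" "v \<in> topspace T"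
      using UV by auto
    then show False
      using left_coset_eq_iff[OF H, of u v] uv by simp
  qed
  then show "\<exists>U V. openin (coset_topology T (\<oplus>) H) U \<and> openin (coset_topology T (\<oplus>) H) V
      \<and> P \<in> U \<and> Q \<in> V \<and> disjnt U V"
    using open_map_left_coset[OF H] UV ab unfolding open_map_def by blast
qed

lemma first_countable_fibre:
  assumes H: "L_subgyrogroup (topspace T) (\<oplus>) gyr H" and "closedin T H"
    and fc: "\<And>L. \<lbrakk>L \<subseteq> H; kappa_in \<kappa> T L\<rbrakk> \<Longrightarrow> first_countable (subtopology T L)"
    and K: "kappa_in \<kappa> T K" and x: "x \<in> topspace T"
  shows "first_countable
    (subtopology T (K \<inter> {y \<in> topspace T. left_coset (\<oplus>) H y = left_coset (\<oplus>) H x}))"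
proof -
  let ?C = "{y \<in> topspace T. left_coset (\<oplus>) H y = left_coset (\<oplus>) H x}"
  let ?L = "(\<oplus>) (\<ominus> x) ` (K \<inter> ?C)"
  \<comment> \<open>In this form the fibre is a preimage of the closed set \<open>H\<close>, so its
    intersection with \<open>K\<close> is again a \<kappa> set, and its translate lies in
    \<open>H\<close>.\<close>
  have C: "?C = {y \<in> topspace T. (\<ominus> x) \<oplus> y \<in> H}"
    using left_coset_eq_iff[OF H x] by blast
  have cont: "continuous_map T T ((\<oplus>) (\<ominus> x))"
    using x by (intro continuous_map_left_translation neg_closed)
  have "kappa_in \<kappa> T ?L"
    unfolding C using kappa_in_Int_closedin[OF K closedin_continuous_map_preimage[OF cont assms(2)]] cont
    by (rule kappa_in_image)
  then have "first_countable (subtopology T ?L)"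
    unfolding C by (intro fc) auto
  moreover have "homeomorphic_maps (subtopology T (K \<inter> ?C)) (subtopology T ?L)
      ((\<oplus>) (\<ominus> x)) ((\<oplus>) (\<ominus> (\<ominus> x)))"
    using homeomorphic_maps_left_translation[OF neg_closed[OF x]]
    by (rule homeomorphic_maps_subtopologies)
      (use x in \<open>auto simp: add_closed neg_closed\<close>)
  ultimately show ?thesis
    using homeomorphic_space_first_countability homeomorphic_maps_imp_homeomorphic_space by blast
qed

end

theorem theorem4p13:
  fixes T :: "'a topology"
    and add :: "'a \<Rightarrow> 'a \<Rightarrow> 'a"
    and zero :: 'a
    and neg :: "'a \<Rightarrow> 'a"
    and gyr :: "'a \<Rightarrow> 'a \<Rightarrow> 'a \<Rightarrow> 'a"
    and H :: "'a set"
    and \<kappa> :: compactness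
  assumes "topological_gyrogroup T add zero neg gyr"
    and "L_subgyrogroup (topspace T) add gyr H"
    and "closedin T H"
    and "\<forall>K. K \<subseteq> H \<and> kappa_in \<kappa> T K \<longrightarrow> first_countable (subtopology T K)"
  shows "((\<forall>K. kappa_in \<kappa> (coset_topology T add H) K
              \<longrightarrow> strongly_Frechet_Urysohn (subtopology (coset_topology T add H) K))
          \<longrightarrow> (\<forall>K. kappa_in \<kappa> T K \<longrightarrow> strongly_Frechet_Urysohn (subtopology T K)))
       \<and> ((\<forall>K. kappa_in \<kappa> (coset_topology T add H) K
              \<longrightarrow> strictly_Frechet_Urysohn (subtopology (coset_topology T add H) K))
          \<longrightarrow> (\<forall>K. kappa_in \<kappa> T K \<longrightarrow> strictly_Frechet_Urysohn (subtopology T K)))"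
proof -
  interpret topological_gyrogroup T add zero neg gyr
    by (rule assms(1))
  let ?p = "left_coset add H" and ?Q = "coset_topology T add H"
  note Q = Hausdorff_space_coset_topology[OF assms(2,3)]
  have p: "continuous_map T ?Q ?p"
    by (rule quotient_imp_continuous_map[OF quotient_map_coset_topology])
  have fibre: "first_countable (subtopology T (K \<inter> {y \<in> topspace T. ?p y = ?p x}))"
    if "kappa_in \<kappa> T K" "x \<in> K" for K x
    using that assms(4) kappa_in_subset[OF that(1)]
    by (intro first_countable_fibre[OF assms(2,3)]) auto
  show ?thesis
    \<comment> \<open>The projection of a \<kappa> set is a \<kappa> set, so the hypotheses on the
      coset space apply to it.\<close>
    using strongly_Frechet_Urysohn_lift[OF regular_space Hausdorff Q p _ fibre]
      strictly_Frechet_Urysohn_lift[OF regular_space Hausdorff Q p _ fibre]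
      kappa_in_image[OF _ p]
    by metis
qed

end
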